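(* Let $K$ and $L$ be compact lines and let $q:K\to L$ be an order preserving continuous surjection. Set $$Q=\{x\in L: x\text{ is an internal point of }L\text{ and }|q^{-1}(x)|>1\}.$$ Then the following hold. (1) $q^*C(L)$ is $1$-complemented in $C(K)$ if and only if $Q=\emptyset$. In this case $q$ admits a right inverse (a continuous map $i:L\to K$ with $q\circ i=\mathrm{id}_L$) and hence also a regular averaging operator. (2) $q^*C(L)$ is complemented in $C(K)$ if and only if $\operatorname{io}(Q)<\infty$. More specifically: (a) if $\operatorname{io}(Q)\ge n$, then any projection $P$ of $C(K)$ onto $q^*C(L)$ satisfies $\|P\|\ge 2+\left\lceil\frac{n-1}{2}\right\rceil$; (b) if $\operatorname{io}(Q)\le n$, then there is a projection $P$ of $C(K)$ onto $q^*C(L)$ with $\|P\|\le 2n+3$.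
   Context: A compact line is a linearly ordered space that is compact in its order topology. A point $x$ of a compact line is external if $x$ is an isolated point of $[x,\to)$ or of $(\leftarrow,x]$; otherwise it is internal. "Order preserving" means nondecreasing. For a continuous surjection $q:K\to L$, $q^*:C(L)\to C(K)$ is $q^*f=f\circ q$ and $q^*C(L)$ is its image. Projections are bounded linear idempotent operators; a subspace is complemented if it is the range of a projection, and $k$-complemented if it is the range of a projection of norm at most $k$. An averaging operator for $q$ is a bounded linear operator $T:C(K)\to C(L)$ with $T(f\circ q)=f$ for every $f\in C(L)$; it is regular if moreover $T1=1$ and $Tf\ge 0$ whenever $f\ge 0$. Internal order: let $X$ be a linearly ordered set and $A\subseteq X$. Put $\operatorname{io}(\emptyset)=-1$. If $A\neq\emptyset$, then for $x\in A$ define inductively: $\operatorname{io}(x,A)\ge 0$ always; for $n\ge1$, $\operatorname{io}(x,A)\ge n$ iff the sets $A^-_{n-1}=\{y\in A: y<x,\ \operatorname{io}(y,A)\ge n-1\}$ and $A^+_{n-1}=\{y\in A:y>x,\ \operatorname{io}(y,A)\ge n-1\}$ are both nonempty and $\sup A^-_{n-1}=\inf A^+_{n-1}=x$. Then $\operatorname{io}(x,A)=\sup\{n\in\{0,1,2,\dots\}:\operatorname{io}(x,A)\ge n\}$ and $\operatorname{io}(A)=\sup\{\operatorname{io}(x,A):x\in A\}$, with values in $\{0,1,2,\dots\}\cup\{\infty\}$ for $A\ne\emptyset$. In the claim $n$ ranges over integers $n\geq -1$. *)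

theory Defs
  imports "HOL-Analysis.Analysis" "HOL-Library.Lub_Glb"
begin

text \<open>
  A compact line is a type of class \<open>linorder_topology\<close> (its topology is the order topology)
  whose \<open>UNIV\<close> is compact.  For such a type \<open>'k\<close>, the space $C(K)$ of real-valued continuous
  functions with the supremum norm is \<open>'k \<Rightarrow>\<^sub>C real\<close>: boundedness is automatic by compactness.
\<close>

definition external_point :: "'a::linorder_topology \<Rightarrow> bool" where
  "external_point x \<longleftrightarrow> x isolated_in {x..} \<or> x isolated_in {..x}"

definition internal_point :: "'a::linorder_topology \<Rightarrow> bool" where
  "internal_point x \<longleftrightarrow> \<not> external_point x"

text \<open>
  The value of \<open>pullback q\<close> is only meaningful for continuous \<open>q\<close>.
\<close>

definition pullback ::
  "('k::topological_space \<Rightarrow> 'l::topological_space) \<Rightarrow> ('l \<Rightarrow>\<^sub>C real) \<Rightarrow> ('k \<Rightarrow>\<^sub>C real)" where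
  "pullback q f = Bcontfun (apply_bcontfun f \<circ> q)"

lemma apply_pullback:
  assumes "continuous_on UNIV q"
  shows "apply_bcontfun (pullback q f) x = apply_bcontfun f (q x)"
proof -
  have "continuous_on UNIV (apply_bcontfun f \<circ> q)"
    using assms by (intro continuous_on_compose) auto
  moreover have "bounded (range (apply_bcontfun f \<circ> q))"
    by (rule bounded_subset[OF bounded_apply_bcontfun[of f]]) auto
  ultimately have "apply_bcontfun f \<circ> q \<in> bcontfun"
    by (simp add: bcontfun_def)
  then show ?thesis
    by (simp add: pullback_def Bcontfun_inverse)
qed

definition projection_onto :: "('a::real_normed_vector \<Rightarrow> 'a) \<Rightarrow> 'a set \<Rightarrow> bool" where
  "projection_onto P M \<longleftrightarrow> bounded_linear P \<and> P \<circ> P = P \<and> range P = M"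

definition complemented :: "'a::real_normed_vector set \<Rightarrow> bool" where
  "complemented M \<longleftrightarrow> (\<exists>P. projection_onto P M)"

definition k_complemented :: "real \<Rightarrow> 'a::real_normed_vector set \<Rightarrow> bool" where
  "k_complemented k M \<longleftrightarrow> (\<exists>P. projection_onto P M \<and> onorm P \<le> k)"

definition averaging_operator ::
  "('k::topological_space \<Rightarrow> 'l::topological_space) \<Rightarrow> (('k \<Rightarrow>\<^sub>C real) \<Rightarrow> ('l \<Rightarrow>\<^sub>C real)) \<Rightarrow> bool" where
  "averaging_operator q T \<longleftrightarrow> bounded_linear T \<and> (\<forall>f. T (pullback q f) = f)"

definition regular_averaging_operator ::
  "('k::topological_space \<Rightarrow> 'l::topological_space) \<Rightarrow> (('k \<Rightarrow>\<^sub>C real) \<Rightarrow> ('l \<Rightarrow>\<^sub>C real)) \<Rightarrow> bool" where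
  "regular_averaging_operator q T \<longleftrightarrow>
     averaging_operator q T \<and> T (const_bcontfun 1) = const_bcontfun 1 \<and>
     (\<forall>f. (\<forall>x. 0 \<le> apply_bcontfun f x) \<longrightarrow> (\<forall>y. 0 \<le> apply_bcontfun (T f) y))"

text \<open>
  \<open>io_at_least A n x\<close> renders $\mathrm{io}(x,A) \ge n$ and is meant for \<open>x \<in> A\<close>.  Suprema and
  infima are taken in the ambient linear order, not in \<open>A\<close>.
\<close>

primrec io_at_least :: "'a::linorder set \<Rightarrow> nat \<Rightarrow> 'a \<Rightarrow> bool" where
  "io_at_least A 0 x \<longleftrightarrow> True"
| "io_at_least A (Suc n) x \<longleftrightarrow>
     {y \<in> A. y < x \<and> io_at_least A n y} \<noteq> {} \<and>
     {y \<in> A. y > x \<and> io_at_least A n y} \<noteq> {} \<and>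
     isLub UNIV {y \<in> A. y < x \<and> io_at_least A n y} x \<and>
     isGlb UNIV {y \<in> A. y > x \<and> io_at_least A n y} x"

definition io_point :: "'a::linorder \<Rightarrow> 'a set \<Rightarrow> ereal" where
  "io_point x A = (SUP n\<in>{n. io_at_least A n x}. ereal (real n))"

definition io :: "'a::linorder set \<Rightarrow> ereal" where
  "io A = (if A = {} then -1 else (SUP x\<in>A. io_point x A))"

definition internal_multiple_points :: "('k \<Rightarrow> 'l::linorder_topology) \<Rightarrow> 'l set" where
  "internal_multiple_points q =
     {x. internal_point x \<and> (\<exists>u\<in>q -` {x}. \<exists>v\<in>q -` {x}. u \<noteq> v)}"

end

theory Submission
  imports Defs
begin

text \<open>
  Projections onto \<open>range (pullback q)\<close> correspond to averaging operators \<open>T\<close> of the same norm.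

  Lower bound: if a function \<open>h\<close> in the unit ball equals \<open>d\<close> near the fibre of \<open>y\<close>, subtracting a
  continuous bump at \<open>y\<close> shows \<open>1 + (d - T h y) \<le> onorm T\<close>.  Near a point of \<open>Q\<close> one can add a jump
  and thereby increase the deviation \<open>d - T h y\<close> by 1 on one side of that point.  At a point of
  internal order \<open>n\<close> this can be iterated \<open>n + 1\<close> times, so \<open>n + 2 \<le> onorm T\<close>, which is at least the
  claimed bound.

  Upper bound: choose a section of \<open>q\<close> that is continuous off \<open>Q\<close> and at each \<open>x \<in> Q\<close> continuous
  from one side, compose with it and remove the remaining jumps (only finitely many of which exceed
  any positive size) by subtracting one-sided bumps.  Each level of the internal order contributes
  at most one active bump, of height at most \<open>2 * norm h\<close>.
\<close>

section \<open>Compact lines and bounded continuous functions\<close>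

lemma compact_continuous_mem_bcontfun:
  fixes f :: "'a::topological_space \<Rightarrow> real"
  assumes "compact (UNIV :: 'a set)" "continuous_on UNIV f"
  shows "f \<in> bcontfun"
  using assms compact_continuous_image[of UNIV f] compact_imp_bounded by (auto simp: bcontfun_def)

lemma norm_bcontfun_le_iff:
  fixes f :: "'a::topological_space \<Rightarrow>\<^sub>C real"
  shows "norm f \<le> b \<longleftrightarrow> (\<forall>x. \<bar>f x\<bar> \<le> b)"
  using norm_bounded[of f] norm_bound[of f b] by (metis order_trans real_norm_def)

text \<open>Urysohn's lemma, available because a compact Hausdorff space is normal.\<close>

lemma compact_t2_separating_function:
  fixes S T :: "'a::t2_space set"
  assumes "compact (UNIV :: 'a set)" "closed S" "closed T" "S \<inter> T = {}" "a \<le> b"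
  obtains f :: "'a \<Rightarrow> real" where "continuous_on UNIV f" "\<And>x. a \<le> f x" "\<And>x. f x \<le> b"
    "\<And>x. x \<in> S \<Longrightarrow> f x = a" "\<And>x. x \<in> T \<Longrightarrow> f x = b"
proof -
  have "Hausdorff_space (euclidean :: 'a topology)"
    by (simp add: Hausdorff_space_def disjnt_def) (meson hausdorff)
  then have "normal_space (euclidean :: 'a topology)"
    using assms by (intro compact_Hausdorff_or_regular_imp_normal_space) (auto simp: compact_space_def)
  then obtain f where "continuous_map euclidean (top_of_set {a..b}) f" "f ` S \<subseteq> {a}" "f ` T \<subseteq> {b}"
    using Urysohn_lemma[of "euclidean :: 'a topology" S T a b] assms by (auto simp: disjnt_def)
  then show thesis
    by (intro that[of f]) (auto simp: continuous_map_in_subtopology image_subset_iff)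
qed

text \<open>A Urysohn function with value 1 at \<open>x\<close> is doubled and truncated at 1, which
  makes it constant on the set where it exceeded 1/2. This plateau \<open>W\<close> allows functions
  to be prescribed on a whole neighbourhood in the lower bound.\<close>

lemma bump_function:
  fixes x :: "'a::t2_space"
  assumes "compact (UNIV :: 'a set)" "open U" "x \<in> U"
  obtains f :: "'a \<Rightarrow> real" and W where "continuous_on UNIV f" "\<And>y. 0 \<le> f y" "\<And>y. f y \<le> 1"
    "\<And>y. y \<notin> U \<Longrightarrow> f y = 0" "open W" "x \<in> W" "\<And>y. y \<in> W \<Longrightarrow> f y = 1"
proof -
  obtain g :: "'a \<Rightarrow> real" where g: "continuous_on UNIV g" "\<And>y. 0 \<le> g y" "\<And>y. g y \<le> 1"
    "\<And>y. y \<in> - U \<Longrightarrow> g y = 0" "\<And>y. y \<in> {x} \<Longrightarrow> g y = 1"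
    using compact_t2_separating_function[of "- U" "{x}" 0 1] assms by auto
  show thesis
  proof (rule that[of "\<lambda>y. min 1 (2 * g y)" "{y. 1/2 < g y}"])
    show "continuous_on UNIV (\<lambda>y. min 1 (2 * g y))"
      using g(1) by (intro continuous_intros)
    show "open {y. 1/2 < g y}"
      using g(1) by (intro open_Collect_less continuous_intros)
  qed (use g in auto)
qed

section \<open>One-sided neighbourhoods in a linear order\<close>

text \<open>If one of these failed, the whole space or an open ray would isolate \<open>x\<close> in
  a closed half-line.\<close>

lemma internal_point_dense:
  assumes "internal_point x"
  shows "\<exists>a. a < x" "a < x \<Longrightarrow> \<exists>y>a. y < x" "\<exists>b. x < b" "x < b \<Longrightarrow> \<exists>y>x. y < b"
proof -
  have L: "\<And>T. open T \<Longrightarrow> T \<inter> {..x} \<noteq> {x}" and R: "\<And>T. open T \<Longrightarrow> T \<inter> {x..} \<noteq> {x}"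
    using assms by (auto simp: internal_point_def external_point_def isolated_in_def)
  show "\<exists>a. a < x" using L[of UNIV] by (auto simp: set_eq_iff order_less_le)
  show "\<exists>b. x < b" using R[of UNIV] by (auto simp: set_eq_iff order_less_le)
  show "\<exists>y>a. y < x" if "a < x"
    using L[of "{a<..}"] that by (auto simp: set_eq_iff order_less_le)
  show "\<exists>y>x. y < b" if "x < b"
    using R[of "{..<b}"] that by (auto simp: set_eq_iff order_less_le)
qed

lemma isolated_in_atLeast_imp_at_right_bot:
  fixes x :: "'a::linorder_topology"
  assumes "x isolated_in {x..}"
  shows "at_right x = bot"
proof -
  have "{x<..} \<subseteq> {x..}" by auto
  then show ?thesis
    using assms by (metis isolated_in_islimpt_iff trivial_limit_within islimpt_subset)
qed

lemma isolated_in_atMost_imp_at_left_bot: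
  fixes x :: "'a::linorder_topology"
  assumes "x isolated_in {..x}"
  shows "at_left x = bot"
proof -
  have "{..<x} \<subseteq> {..x}" by auto
  then show ?thesis
    using assms by (metis isolated_in_islimpt_iff trivial_limit_within islimpt_subset)
qed

text \<open>\<open>N\<close> is the intersection of an upward closed and a downward closed open set.
  They are built separately because \<open>x\<close> may be an endpoint of the line, where the whole
  space serves for the missing side.\<close>

lemma open_contains_interval_neighbourhood:
  fixes x :: "'a::linorder_topology"
  assumes "open S" "x \<in> S"
  obtains N where "open N" "x \<in> N" "N \<subseteq> S" "\<And>u v w. u \<in> N \<Longrightarrow> w \<in> N \<Longrightarrow> u \<le> v \<Longrightarrow> v \<le> w \<Longrightarrow> v \<in> N"
proof -
  have "\<exists>A. open A \<and> x \<in> A \<and> (\<forall>u\<in>A. \<forall>v\<ge>u. v \<in> A) \<and> A \<inter> {..x} \<subseteq> S"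
  proof (cases "\<exists>y. y < x")
    case True
    then obtain b where "b < x" "{b<..x} \<subseteq> S"
      using open_left[OF assms] by blast
    then show ?thesis by (intro exI[of _ "{b<..}"]) auto
  next
    case False
    then have "{..x} = {x}" by (auto simp: not_less intro: order.antisym)
    then show ?thesis using assms by (intro exI[of _ UNIV]) auto
  qed
  then obtain A where A: "open A" "x \<in> A" "\<forall>u\<in>A. \<forall>v\<ge>u. v \<in> A" "A \<inter> {..x} \<subseteq> S" by blast
  have "\<exists>B. open B \<and> x \<in> B \<and> (\<forall>u\<in>B. \<forall>v\<le>u. v \<in> B) \<and> B \<inter> {x..} \<subseteq> S"
  proof (cases "\<exists>y. x < y")
    case True
    then obtain b where "x < b" "{x..<b} \<subseteq> S"
      using open_right[OF assms] by blast
    then show ?thesis by (intro exI[of _ "{..<b}"]) auto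
  next
    case False
    then have "{x..} = {x}" by (auto simp: not_less intro: order.antisym)
    then show ?thesis using assms by (intro exI[of _ UNIV]) auto
  qed
  then obtain B where B: "open B" "x \<in> B" "\<forall>u\<in>B. \<forall>v\<le>u. v \<in> B" "B \<inter> {x..} \<subseteq> S" by blast
  show thesis
  proof (rule that[of "A \<inter> B"])
    show "A \<inter> B \<subseteq> S"
    proof
      fix y assume "y \<in> A \<inter> B"
      then show "y \<in> S" using A(4) B(4) by (cases "y \<le> x") auto
    qed
  qed (use A B in \<open>auto intro: open_Int\<close>)
qed

section \<open>Internal order\<close>

lemma isLub_UNIV_iff:
  "isLub UNIV S x \<longleftrightarrow> (\<forall>y\<in>S. y \<le> x) \<and> (\<forall>z. (\<forall>y\<in>S. y \<le> z) \<longrightarrow> x \<le> z)"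
  by (simp add: isLub_def leastP_def isUb_def setle_def setge_def)

lemma isGlb_UNIV_iff:
  "isGlb UNIV S x \<longleftrightarrow> (\<forall>y\<in>S. x \<le> y) \<and> (\<forall>z. (\<forall>y\<in>S. z \<le> y) \<longrightarrow> z \<le> x)"
  by (simp add: isGlb_def greatestP_def isLb_def setle_def setge_def)

text \<open>Enlarging a set that stays strictly on one side of \<open>x\<close> keeps
  \<open>x\<close> as its supremum or infimum, and by induction the sets for a smaller order contain
  those for a larger one.\<close>

lemma io_at_least_antimono:
  assumes "io_at_least A n x" "m \<le> n"
  shows "io_at_least A m x"
proof -
  have step: "io_at_least A (Suc k) x \<Longrightarrow> io_at_least A k x" for k x
  proof (induction k arbitrary: x)
    case (Suc k)
    define L R where "L n = {y \<in> A. y < x \<and> io_at_least A n y}"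
      and "R n = {y \<in> A. y > x \<and> io_at_least A n y}" for n
    have io_Suc: "io_at_least A (Suc n) x \<longleftrightarrow>
        L n \<noteq> {} \<and> R n \<noteq> {} \<and> isLub UNIV (L n) x \<and> isGlb UNIV (R n) x" for n
      by (simp add: L_def R_def)
    have "L (Suc k) \<subseteq> L k" "R (Suc k) \<subseteq> R k"
      unfolding L_def R_def using Suc.IH by blast+
    moreover have "\<And>y. y \<in> L k \<Longrightarrow> y < x" "\<And>y. y \<in> R k \<Longrightarrow> x < y"
      by (simp_all add: L_def R_def)
    moreover have "isLub UNIV T x" if "isLub UNIV S x" "S \<subseteq> T" "\<And>y. y \<in> T \<Longrightarrow> y < x" for S T
      using that unfolding isLub_UNIV_iff by (meson less_imp_le subsetD)
    moreover have "isGlb UNIV T x" if "isGlb UNIV S x" "S \<subseteq> T" "\<And>y. y \<in> T \<Longrightarrow> x < y" for S T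
      using that unfolding isGlb_UNIV_iff by (meson less_imp_le subsetD)
    ultimately show ?case
      using Suc.prems unfolding io_Suc[of k] io_Suc[of "Suc k"] by blast
  qed simp
  show ?thesis
    using assms(2,1) by (induction rule: dec_induct) (use step in blast)+
qed

lemma io_at_least_imp_le_io:
  assumes "x \<in> A" "io_at_least A n x"
  shows "ereal (real n) \<le> io A"
proof -
  have "ereal (real n) \<le> io_point x A"
    unfolding io_point_def using assms(2) by (intro SUP_upper) simp
  also have "\<dots> \<le> io A"
    using assms(1) by (auto simp: io_def intro: SUP_upper)
  finally show ?thesis .
qed

text \<open>If no point had order at least \<open>n\<close>, all orders would be at most
  \<open>n - 1\<close>, and their supremum with them.\<close>

lemma le_io_imp_io_at_least:
  assumes "ereal (real n) \<le> io A"
  shows "\<exists>x\<in>A. io_at_least A n x"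
proof (rule ccontr)
  assume none: "\<not> ?thesis"
  have "A \<noteq> {}" using assms by (auto simp: io_def one_ereal_def)
  then have "0 < n" using none by (cases n) auto
  have "m \<le> n - 1" if "x \<in> A" "io_at_least A m x" for x m
    using none that io_at_least_antimono[of A m x n] \<open>0 < n\<close> by fastforce
  then have "io A \<le> ereal (real (n - 1))"
    using \<open>A \<noteq> {}\<close> by (auto simp: io_def io_point_def intro!: SUP_least)
  also have "\<dots> < ereal (real n)" using \<open>0 < n\<close> by simp
  finally show False using assms by simp
qed

text \<open>Each point uses its right side if \<open>A\<close> leaves a gap there, and its left side
  otherwise. The intervals lie inside gaps, so only two neighbours facing each other can clash;
  these are cut at a common point of the gap.\<close>

lemma disjoint_one_sided_intervals:
  fixes A :: "'a::linorder set"
  assumes dense: "\<And>x a. x \<in> A \<Longrightarrow> a < x \<Longrightarrow> \<exists>y>a. y < x"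
    and isolated: "\<And>x. x \<in> A \<Longrightarrow> (\<exists>z>x. \<forall>c\<in>A. \<not> (x < c \<and> c < z)) \<or> (\<exists>z<x. \<forall>c\<in>A. \<not> (z < c \<and> c < x))"
  shows "\<exists>right I. \<forall>x\<in>A. (if right x then \<exists>z>x. I x = {x<..<z} else \<exists>z<x. I x = {z<..<x})
    \<and> (\<forall>x'\<in>A. x \<noteq> x' \<longrightarrow> I x \<inter> I x' = {})"
proof -
  define near where "near a b \<longleftrightarrow> a \<in> A \<and> b \<in> A \<and> a < b \<and> (\<forall>c\<in>A. \<not> (a < c \<and> c < b))" for a b
  \<comment> \<open>The chosen point depends only on the pair, so both neighbours respect the same
    cut.\<close>
  define mid where "mid a b = (SOME y. a < y \<and> y < b)" for a b :: 'a
  have mid: "a < mid a b" "mid a b < b" if "near a b" for a b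
    using that dense[of b a] someI_ex[of "\<lambda>y. a < y \<and> y < b"]
    by (auto simp: near_def mid_def)
  define right where "right x \<longleftrightarrow> (\<exists>z>x. \<forall>c\<in>A. \<not> (x < c \<and> c < z))" for x
  have "\<exists>z. if right x then x < z \<and> (\<forall>c\<in>A. \<not> (x < c \<and> c < z)) \<and> (\<forall>b. near x b \<longrightarrow> z \<le> mid x b)
    else z < x \<and> (\<forall>c\<in>A. \<not> (z < c \<and> c < x)) \<and> (\<forall>a. near a x \<longrightarrow> mid a x \<le> z)"
    (is "\<exists>z. ?P x z") if x: "x \<in> A" for x
  proof (cases "right x")
    case True
    show ?thesis
    proof (cases "\<exists>b. near x b")
      case ex: True
      then obtain b where b: "near x b" by blast
      then have "b' = b" if "near x b'" for b'
        using that b by (metis near_def linorder_neqE)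
      then have "\<forall>b'. near x b' \<longrightarrow> mid x b \<le> mid x b'" by auto
      moreover have "\<forall>c\<in>A. \<not> (x < c \<and> c < mid x b)"
        using b mid(2)[OF b] by (meson near_def order.strict_trans)
      ultimately show ?thesis
        using mid(1)[OF b] True by auto
    qed (use True in \<open>auto simp: right_def\<close>)
  next
    case False
    show ?thesis
    proof (cases "\<exists>a. near a x")
      case ex: True
      then obtain a where a: "near a x" by blast
      then have "a' = a" if "near a' x" for a'
        using that a by (metis near_def linorder_neqE)
      then have "\<forall>a'. near a' x \<longrightarrow> mid a' x \<le> mid a x" by auto
      moreover have "\<forall>c\<in>A. \<not> (mid a x < c \<and> c < x)"
        using a mid(1)[OF a] by (meson near_def order.strict_trans)
      ultimately show ?thesis
        using mid(2)[OF a] False by auto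
    next
      case none: False
      obtain z where "z < x" "\<forall>c\<in>A. \<not> (z < c \<and> c < x)"
        using isolated[OF x] False unfolding right_def by blast
      then show ?thesis using none False by (intro exI[of _ z]) simp
    qed
  qed
  then have "\<forall>x\<in>A. \<exists>z. ?P x z" by blast
  then obtain z where "\<forall>x\<in>A. ?P x (z x)" by (rule bchoice[THEN exE])
  then have z: "\<And>x. x \<in> A \<Longrightarrow> right x \<Longrightarrow> x < z x"
    "\<And>x c. x \<in> A \<Longrightarrow> right x \<Longrightarrow> c \<in> A \<Longrightarrow> x < c \<Longrightarrow> z x \<le> c"
    "\<And>x b. x \<in> A \<Longrightarrow> right x \<Longrightarrow> near x b \<Longrightarrow> z x \<le> mid x b"
    "\<And>x. x \<in> A \<Longrightarrow> \<not> right x \<Longrightarrow> z x < x"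
    "\<And>x c. x \<in> A \<Longrightarrow> \<not> right x \<Longrightarrow> c \<in> A \<Longrightarrow> c < x \<Longrightarrow> c \<le> z x"
    "\<And>x a. x \<in> A \<Longrightarrow> \<not> right x \<Longrightarrow> near a x \<Longrightarrow> mid a x \<le> z x"
    by (auto simp flip: not_less)
  define I where "I x = (if right x then {x<..<z x} else {z x<..<x})" for x
  have disjoint: "y \<notin> I x'" if "x \<in> A" "x' \<in> A" "x < x'" "y \<in> I x" for x x' y
  proof
    assume y: "y \<in> I x'"
    consider "right x" "\<not> right x'" | "right x" "right x'" | "\<not> right x" by blast
    then show False
    proof cases
      case 1
      then have "x < y" "y < z x" "z x' < y" "y < x'" using that y by (auto simp: I_def)
      \<comment> \<open>A point of \<open>A\<close> between \<open>x\<close> and \<open>x'\<close>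
        would lie between \<open>z x\<close> and \<open>z x'\<close> in the order that keeps the two
        intervals apart.\<close>
      moreover have "near x x'"
        unfolding near_def
      proof (intro conjI ballI notI that(1-3))
        fix c assume "c \<in> A" "x < c \<and> c < x'"
        then have "z x \<le> c" "c \<le> z x'" using z(2,5) that 1 by blast+
        then show False using calculation by simp
      qed
      ultimately show False using z(3)[of x x'] z(6)[of x' x] 1 that by simp
    next
      case 2
      then show False using that y z(2)[of x x'] by (auto simp: I_def)
    next
      case 3
      then show False using that y z(5)[of x' x] by (cases "right x'") (auto simp: I_def)
    qed
  qed
  show ?thesis
  proof (intro exI[of _ right] exI[of _ I] ballI conjI impI)
    fix x assume "x \<in> A"
    then show "if right x then \<exists>z>x. I x = {x<..<z} else \<exists>z<x. I x = {z<..<x}"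
      using z(1,4) by (auto simp: I_def)
    fix x' assume "x' \<in> A" "x \<noteq> x'"
    then show "I x \<inter> I x' = {}"
      using disjoint[of x x'] disjoint[of x' x] \<open>x \<in> A\<close> by (cases "x < x'") (auto simp: not_less)
  qed
qed

section \<open>Projections and averaging operators\<close>

locale compact_line_surjection =
  fixes q :: "'k::linorder_topology \<Rightarrow> 'l::linorder_topology"
  assumes compact_domain: "compact (UNIV :: 'k set)"
    and compact_codomain: "compact (UNIV :: 'l set)"
    and mono: "mono q"
    and cont: "continuous_on UNIV q"
    and surj: "surj q"
begin

lemma pullback_apply [simp]: "pullback q f x = f (q x)"
  by (rule apply_pullback[OF cont])

lemma less_if_q_less: "q u < q v \<Longrightarrow> u < v"
  using mono by (metis monoD not_le)

lemma norm_pullback [simp]: "norm (pullback q f) = norm f"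
proof (rule antisym)
  show "norm (pullback q f) \<le> norm f"
    using norm_bounded[of f] by (intro norm_bound) auto
  show "norm f \<le> norm (pullback q f)"
  proof (rule norm_bound)
    fix y
    obtain u where "y = q u" using surj by auto
    then show "norm (f y) \<le> norm (pullback q f)"
      using norm_bounded[of "pullback q f" u] by simp
  qed
qed

lemma bounded_linear_pullback: "bounded_linear (pullback q)"
  by (rule bounded_linear_intro[of _ 1]) (auto intro!: bcontfun_eqI)

lemma inj_pullback: "inj (pullback q)"
proof (rule injI)
  fix f g assume "pullback q f = pullback q g"
  then have "norm (f - g) = 0"
    using norm_pullback[of "f - g"] bounded_linear_pullback
    by (simp add: linear_diff bounded_linear.linear)
  then show "f = g" by simp
qed

text \<open>As \<open>pullback q\<close> is an isometric embedding, the values of \<open>P\<close>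
  can be transported back along it; linearity and the norm bound come along.\<close>

lemma averaging_operator_of_projection:
  assumes P: "projection_onto P (range (pullback q))"
  obtains T where "averaging_operator q T" "onorm T \<le> onorm P"
proof -
  have bl: "bounded_linear P" and PP: "P \<circ> P = P" and ran: "range P = range (pullback q)"
    using P by (auto simp: projection_onto_def)
  define T where "T f = inv (pullback q) (P f)" for f
  have PT: "P f = pullback q (T f)" for f
    unfolding T_def by (metis f_inv_into_f ran rangeI)
  have fixes_range: "P (pullback q f) = pullback q f" for f
    using PP ran by (metis comp_apply rangeE rangeI)
  have "norm (T f) \<le> onorm P * norm f" for f
    using onorm[OF bl, of f] by (simp add: PT)
  moreover have "T (f + g) = T f + T g" for f g
    by (rule injD[OF inj_pullback])
      (simp add: bounded_linear_pullback bl linear_add bounded_linear.linear flip: PT)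
  moreover have "T (r *\<^sub>R f) = r *\<^sub>R T f" for f r
    by (rule injD[OF inj_pullback])
      (simp add: bounded_linear_pullback bl linear_scale bounded_linear.linear flip: PT)
  ultimately have "bounded_linear T"
    by (intro bounded_linear_intro[of _ "onorm P"]) (auto simp: mult.commute)
  moreover have "T (pullback q f) = f" for f
    by (rule injD[OF inj_pullback]) (simp add: fixes_range flip: PT)
  ultimately show thesis
    using \<open>\<And>f. norm (T f) \<le> onorm P * norm f\<close> onorm_pos_le[OF bl]
    by (intro that[of T] onorm_bound) (auto simp: averaging_operator_def)
qed

lemma projection_of_averaging_operator:
  assumes T: "averaging_operator q T"
  shows "projection_onto (pullback q \<circ> T) (range (pullback q))"
    and "onorm (pullback q \<circ> T) \<le> onorm T"
proof -
  have bl: "bounded_linear T" and Tq: "\<And>f. T (pullback q f) = f"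
    using T by (auto simp: averaging_operator_def)
  have "range (pullback q \<circ> T) = range (pullback q)"
    using Tq by (metis (no_types) image_comp surj_def)
  then show "projection_onto (pullback q \<circ> T) (range (pullback q))"
    using Tq bounded_linear_compose[OF bounded_linear_pullback bl]
    by (auto simp: projection_onto_def o_def)
  show "onorm (pullback q \<circ> T) \<le> onorm T"
    using onorm[OF bl] onorm_pos_le[OF bl] by (intro onorm_bound) auto
qed

section \<open>Lower bound\<close>

text \<open>Subtracting a bump of height \<open>1 + d\<close> lowers the value over \<open>y\<close>
  from \<open>d\<close> to -1 without leaving the unit ball. Since \<open>T\<close> reproduces the
  bump exactly, any shortfall of \<open>T h y\<close> against \<open>d\<close> becomes a shortfall
  against -1.\<close>

lemma onorm_averaging_operator_ge_deviation:
  fixes h :: "'k \<Rightarrow>\<^sub>C real" and T :: "('k \<Rightarrow>\<^sub>C real) \<Rightarrow> ('l \<Rightarrow>\<^sub>C real)"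
  assumes T: "averaging_operator q T" and h: "norm h \<le> 1"
    and U: "open U" "y \<in> U" "\<And>u. q u \<in> U \<Longrightarrow> h u = d"
  shows "1 + (d - T h y) \<le> onorm T"
proof -
  have bl: "bounded_linear T" and Tq: "\<And>f. T (pullback q f) = f"
    using T by (auto simp: averaging_operator_def)
  obtain f :: "'l \<Rightarrow> real" and W where f: "continuous_on UNIV f" "\<And>y. 0 \<le> f y" "\<And>y. f y \<le> 1"
    "\<And>y. y \<notin> U \<Longrightarrow> f y = 0" "y \<in> W" "\<And>y. y \<in> W \<Longrightarrow> f y = 1"
    using bump_function[OF compact_codomain U(1,2)] by metis
  obtain F :: "'l \<Rightarrow>\<^sub>C real" where F: "f = apply_bcontfun F"
    using compact_continuous_mem_bcontfun[OF compact_codomain f(1)] bcontfunE by blast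
  obtain u0 where "q u0 = y" using surj by (metis surjD)
  then have d: "\<bar>d\<bar> \<le> 1" using h U by (metis norm_bcontfun_le_iff)
  define k where "k = h - (1 + d) *\<^sub>R pullback q F"
  have "norm k \<le> 1"
    unfolding norm_bcontfun_le_iff
  proof
    fix u
    show "\<bar>k u\<bar> \<le> 1"
    proof (cases "q u \<in> U")
      case True
      define A where "A = (1 - f (q u)) * d"
      \<comment> \<open>A convex combination of \<open>d\<close> and -1 with weights
        \<open>1 - f (q u)\<close> and \<open>f (q u)\<close>.\<close>
      have "k u = A - f (q u)"
        using U(3)[OF True] by (simp add: k_def A_def F algebra_simps)
      moreover have "\<bar>A\<bar> \<le> (1 - f (q u)) * 1"
        unfolding A_def abs_mult using f(3)[of "q u"] d by (intro mult_mono) auto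
      ultimately show ?thesis using f(2)[of "q u"] by (simp add: abs_le_iff)
    next
      case False
      then show ?thesis using f(4) h by (simp add: k_def norm_bcontfun_le_iff flip: F)
    qed
  qed
  moreover have "T k = T h - (1 + d) *\<^sub>R F"
    unfolding k_def using bl Tq by (simp add: linear_diff linear_scale bounded_linear.linear)
  then have "T k y = T h y - (1 + d)"
    using f(5,6) by (simp flip: F)
  then have "1 + (d - T h y) \<le> norm (T k)"
    using norm_bounded[of "T k" y] by auto
  ultimately show ?thesis
    using onorm[OF bl, of k] onorm_pos_le[OF bl]
    by (meson mult_left_le order_trans)
qed

text \<open>A function jumping by 2 at \<open>x\<close> is one away from its continuous average on one of the
  two sides of \<open>x\<close>, so adding such a jump raises the deviation \<open>h - T h\<close> by one on that side.\<close>

lemma averaging_operator_increase_deviation: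
  fixes h :: "'k \<Rightarrow>\<^sub>C real" and T :: "('k \<Rightarrow>\<^sub>C real) \<Rightarrow> ('l \<Rightarrow>\<^sub>C real)"
  assumes T: "averaging_operator q T" and x: "x \<in> internal_multiple_points q"
    and h: "norm h \<le> 1" and U: "open U" "x \<in> U" "\<And>u. q u \<in> U \<Longrightarrow> h u = d"
    and r: "r \<le> d - T h x" and e: "0 < e"
  obtains h' :: "'k \<Rightarrow>\<^sub>C real" and V where "norm h' \<le> 1" "open V" "(\<exists>z>x. V = {x<..<z}) \<or> (\<exists>z<x. V = {z<..<x})"
    "\<And>u. q u \<in> V \<Longrightarrow> h' u = 1" "\<And>y. y \<in> V \<Longrightarrow> r + 1 - e \<le> 1 - T h' y"
proof -
  have bl: "bounded_linear T" and Tq: "\<And>f. T (pullback q f) = f"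
    using T by (auto simp: averaging_operator_def)
  obtain f :: "'l \<Rightarrow> real" and W where f: "continuous_on UNIV f" "\<And>y. 0 \<le> f y" "\<And>y. f y \<le> 1"
    "\<And>y. y \<notin> U \<Longrightarrow> f y = 0" "open W" "x \<in> W" "\<And>y. y \<in> W \<Longrightarrow> f y = 1"
    using bump_function[OF compact_codomain U(1,2)] by metis
  obtain F :: "'l \<Rightarrow>\<^sub>C real" where F: "f = apply_bcontfun F"
    using compact_continuous_mem_bcontfun[OF compact_codomain f(1)] bcontfunE by blast
  obtain a b where ab: "q a = x" "q b = x" "a < b"
    using x by (auto simp: internal_multiple_points_def) (metis linorder_neqE)
  \<comment> \<open>The transition of \<open>E\<close> happens inside the fibre of \<open>x\<close>:
    over points below \<open>x\<close> it is -1, over points above \<open>x\<close> it is 1.\<close>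
  obtain E :: "'k \<Rightarrow> real" where E: "continuous_on UNIV E" "\<And>u. -1 \<le> E u" "\<And>u. E u \<le> 1"
    "\<And>u. u \<in> {..a} \<Longrightarrow> E u = -1" "\<And>u. u \<in> {b..} \<Longrightarrow> E u = 1"
    by (rule compact_t2_separating_function[OF compact_domain, of "{..a}" "{b..}" "-1" 1])
      (use ab in auto)
  have "continuous_on UNIV (\<lambda>u. E u * f (q u))"
    by (intro continuous_intros E(1) continuous_on_compose2[OF f(1) cont]) auto
  then obtain j where j: "(\<lambda>u. E u * f (q u)) = apply_bcontfun j"
    using compact_continuous_mem_bcontfun[OF compact_domain] bcontfunE by blast
  then have j_eq: "j u = E u * f (q u)" for u by metis
  \<comment> \<open>The sign makes the contribution of \<open>j\<close> at \<open>x\<close>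
    nonpositive; it also decides on which side of \<open>x\<close> the new function equals
    1.\<close>
  obtain s :: real where s: "s = 1 \<or> s = -1" "s * T j x \<le> 0"
    by (metis minus_mult_left mult_1 linear neg_le_0_iff_le)
  \<comment> \<open>Over \<open>U\<close> the constant \<open>d\<close> is replaced by a convex
    combination of \<open>d\<close> and \<open>s * E\<close>. Since \<open>T\<close> returns
    \<open>F\<close> from its pullback, \<open>T h' x\<close> is at most \<open>-r\<close>.\<close>
  define h' where "h' = h - d *\<^sub>R pullback q F + s *\<^sub>R j"
  have Th': "T h' = T h - d *\<^sub>R F + s *\<^sub>R T j"
    unfolding h'_def using bl Tq
    by (simp add: linear_diff linear_add linear_scale bounded_linear.linear)
  have d: "\<bar>d\<bar> \<le> 1" using h U ab by (metis norm_bcontfun_le_iff)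
  have "norm h' \<le> 1"
    unfolding norm_bcontfun_le_iff
  proof
    fix u
    show "\<bar>h' u\<bar> \<le> 1"
    proof (cases "q u \<in> U")
      case True
      define A B where "A = (1 - f (q u)) * d" and "B = f (q u) * (s * E u)"
      have "h' u = A + B"
        using U(3)[OF True] by (simp add: h'_def A_def B_def j_eq algebra_simps flip: F)
      moreover have "\<bar>A\<bar> \<le> (1 - f (q u)) * 1"
        unfolding A_def abs_mult using f(3)[of "q u"] d by (intro mult_mono) auto
      moreover have "\<bar>B\<bar> \<le> f (q u) * 1"
        unfolding B_def abs_mult using f(2)[of "q u"] s(1) E(2,3)[of u] by (intro mult_mono) auto
      ultimately show ?thesis by (simp add: abs_le_iff)
    next
      case False
      then show ?thesis using f(4) h by (simp add: h'_def j_eq norm_bcontfun_le_iff flip: F)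
    qed
  qed
  \<comment> \<open>By continuity \<open>T h'\<close> stays below \<open>e - r\<close> near
    \<open>x\<close>, while over \<open>W\<close> the function \<open>h'\<close> is exactly
    \<open>s * E\<close>.\<close>
  define N where "N = {y. T h' y < e - r} \<inter> W"
  have N: "r + 1 - e \<le> 1 - T h' y" "y \<in> W" if "y \<in> N" for y
    using that by (auto simp: N_def)
  have "open N"
    unfolding N_def by (intro open_Int f(5) open_Collect_less continuous_intros) auto
  moreover have "T h' x = T h x - d + s * T j x"
    using f(6,7) by (simp add: Th' flip: F)
  then have "x \<in> N"
    using r e s(2) f(6) by (simp add: N_def)
  moreover have "internal_point x"
    using x by (simp add: internal_multiple_points_def)
  ultimately have LR: "\<exists>z>x. {x..<z} \<subseteq> N" "\<exists>z<x. {z<..x} \<subseteq> N"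
    using open_right[of N x] open_left[of N x] internal_point_dense(1,3)[of x] by blast+
  show thesis
  proof (cases "s = 1")
    case True
    obtain z where z: "x < z" "{x..<z} \<subseteq> N" using LR(1) by blast
    show thesis
    proof (rule that[of h' "{x<..<z}"])
      show "r + 1 - e \<le> 1 - T h' y" if "y \<in> {x<..<z}" for y
        using z that by (intro N(1)) auto
    next
      fix u assume u: "q u \<in> {x<..<z}"
      then have "E u = 1" using less_if_q_less[of b u] ab by (intro E(5)) auto
      moreover have "q u \<in> W" using u z by (intro N(2)) auto
      ultimately show "h' u = 1"
        using x f(4)[of "q u"] f(7)[of "q u"] U(3)[of u] True by (auto simp: h'_def j_eq simp flip: F)
    qed (use z \<open>norm h' \<le> 1\<close> in auto)
  next
    case False
    then have s1: "s = -1" using s by simp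
    obtain z where z: "z < x" "{z<..x} \<subseteq> N" using LR(2) by blast
    show thesis
    proof (rule that[of h' "{z<..<x}"])
      show "r + 1 - e \<le> 1 - T h' y" if "y \<in> {z<..<x}" for y
        using z that by (intro N(1)) auto
    next
      fix u assume u: "q u \<in> {z<..<x}"
      then have "E u = -1" using less_if_q_less[of u a] ab by (intro E(4)) auto
      moreover have "q u \<in> W" using u z by (intro N(2)) auto
      ultimately show "h' u = 1"
        using x f(4)[of "q u"] f(7)[of "q u"] U(3)[of u] s1 by (auto simp: h'_def j_eq simp flip: F)
    qed (use z \<open>norm h' \<le> 1\<close> in auto)
  qed
qed

text \<open>The starting function and deviation are arbitrary because the induction restarts, at a
  point of one order less, from the function just built, with \<open>d = 1\<close> and deviation
  \<open>r + 1 - e\<close>.\<close>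

lemma onorm_averaging_operator_ge_io:
  fixes h :: "'k \<Rightarrow>\<^sub>C real" and T :: "('k \<Rightarrow>\<^sub>C real) \<Rightarrow> ('l \<Rightarrow>\<^sub>C real)"
  assumes T: "averaging_operator q T"
    and x: "x \<in> internal_multiple_points q" "io_at_least (internal_multiple_points q) n x"
    and h: "norm h \<le> 1" and U: "open U" "x \<in> U" "\<And>u. q u \<in> U \<Longrightarrow> h u = d"
    and r: "r \<le> d - T h x"
  shows "real n + 2 + r \<le> onorm T"
  using x h U r
proof (induction n arbitrary: x h U d r)
  case (0 x h U d r)
  show ?case
  proof (rule field_le_epsilon)
    fix e :: real assume "0 < e"
    then obtain h' :: "'k \<Rightarrow>\<^sub>C real" and V where h': "norm h' \<le> 1" "open V"
      "(\<exists>z>x. V = {x<..<z}) \<or> (\<exists>z<x. V = {z<..<x})"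
      "\<And>u. q u \<in> V \<Longrightarrow> h' u = 1" "\<And>y. y \<in> V \<Longrightarrow> r + 1 - e \<le> 1 - T h' y"
      using averaging_operator_increase_deviation[OF T 0(1,3-7)] by metis
    obtain y where y: "y \<in> V"
      using h'(3) internal_point_dense(2,4)[of x] 0(1) by (fastforce simp: internal_multiple_points_def)
    show "real 0 + 2 + r \<le> onorm T + e"
      using onorm_averaging_operator_ge_deviation[OF T h'(1,2) y h'(4)] h'(5)[OF y] by simp
  qed
next
  case (Suc n x h U d r)
  let ?Q = "internal_multiple_points q"
  show ?case
  proof (rule field_le_epsilon)
    fix e :: real assume "0 < e"
    then obtain h' :: "'k \<Rightarrow>\<^sub>C real" and V where h': "norm h' \<le> 1" "open V"
      "(\<exists>z>x. V = {x<..<z}) \<or> (\<exists>z<x. V = {z<..<x})"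
      "\<And>u. q u \<in> V \<Longrightarrow> h' u = 1" "\<And>y. y \<in> V \<Longrightarrow> r + 1 - e \<le> 1 - T h' y"
      using averaging_operator_increase_deviation[OF T Suc.prems(1,3-7)] by metis
    have lub: "isLub UNIV {y \<in> ?Q. y < x \<and> io_at_least ?Q n y} x"
      and glb: "isGlb UNIV {y \<in> ?Q. y > x \<and> io_at_least ?Q n y} x"
      using Suc.prems(2) by simp_all
    \<comment> \<open>The side of \<open>V\<close> is dictated by \<open>T\<close>, so points of
      order \<open>n\<close> must accumulate at \<open>x\<close> from both sides.\<close>
    have "\<exists>y\<in>?Q. io_at_least ?Q n y \<and> y \<in> V"
      using h'(3)
    proof
      assume "\<exists>z>x. V = {x<..<z}"
      then obtain z where z: "x < z" "V = {x<..<z}" by blast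
      then show ?thesis
        using isGlb_le_isLb[OF glb, of z] by (force simp: isLb_def setge_def)
    next
      assume "\<exists>z<x. V = {z<..<x}"
      then obtain z where z: "z < x" "V = {z<..<x}" by blast
      then show ?thesis
        using isLub_le_isUb[OF lub, of z] by (force simp: isUb_def setle_def)
    qed
    then obtain y where y: "y \<in> ?Q" "io_at_least ?Q n y" "y \<in> V" by blast
    show "real (Suc n) + 2 + r \<le> onorm T + e"
      using Suc.IH[OF y(1,2) h'(1,2) y(3) h'(4) h'(5)[OF y(3)]] by simp
  qed
qed

section \<open>Jumps and sections\<close>

definition fibre_min :: "'l \<Rightarrow> 'k" where
  "fibre_min y = (SOME u. q u = y \<and> (\<forall>v. q v = y \<longrightarrow> u \<le> v))"

definition fibre_max :: "'l \<Rightarrow> 'k" where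
  "fibre_max y = (SOME u. q u = y \<and> (\<forall>v. q v = y \<longrightarrow> v \<le> u))"

lemma compact_fibre: "compact (q -` {y})"
  using compact_Int_closed[OF compact_domain closed_vimage[OF closed_singleton cont], of y] by simp

lemma fibre_nonempty: "q -` {y} \<noteq> {}"
  using surj by (metis empty_iff surjD vimage_singleton_eq)

lemma fibre_min: "q (fibre_min y) = y" "q v = y \<Longrightarrow> fibre_min y \<le> v"
proof -
  have "\<exists>u. q u = y \<and> (\<forall>v. q v = y \<longrightarrow> u \<le> v)"
    using compact_attains_inf[OF compact_fibre fibre_nonempty, of y] by auto
  from someI_ex[OF this] show "q (fibre_min y) = y" "q v = y \<Longrightarrow> fibre_min y \<le> v"
    by (auto simp: fibre_min_def)
qed

lemma fibre_max: "q (fibre_max y) = y" "q v = y \<Longrightarrow> v \<le> fibre_max y"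
proof -
  have "\<exists>u. q u = y \<and> (\<forall>v. q v = y \<longrightarrow> v \<le> u)"
    using compact_attains_sup[OF compact_fibre fibre_nonempty, of y] by auto
  from someI_ex[OF this] show "q (fibre_max y) = y" "q v = y \<Longrightarrow> v \<le> fibre_max y"
    by (auto simp: fibre_max_def)
qed

text \<open>Monotonicity forces the limit: below \<open>x\<close> a section stays left of the fibre
  of \<open>x\<close>, and a point \<open>a\<close> left of that fibre has \<open>q a < x\<close>,
  so it is passed once \<open>y\<close> exceeds \<open>q a\<close>.\<close>

lemma section_tendsto_at_left:
  fixes s :: "'l \<Rightarrow> 'k" and x :: 'l
  assumes s: "\<And>y. q (s y) = y"
  shows "(s \<longlongrightarrow> fibre_min x) (at_left x)"
proof (rule order_tendstoI)
  fix a assume a: "a < fibre_min x"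
  then have "q a < x"
    using fibre_min(1)[of x] fibre_min(2)[of a x] less_if_q_less[of "fibre_min x" a]
      less_if_q_less[of a "fibre_min x"] by (metis leD less_asym linorder_neqE)
  then show "\<forall>\<^sub>F y in at_left x. a < s y"
    by (intro eventually_at_leftI[of "q a"]) (auto intro: less_if_q_less simp: s)
next
  fix a assume "fibre_min x < a"
  then have "s y < a" if "y < x" for y
    using less_if_q_less[of "s y" "fibre_min x"] that by (simp add: s fibre_min(1))
  then show "\<forall>\<^sub>F y in at_left x. s y < a"
    by (simp add: eventually_at_filter)
qed

lemma section_tendsto_at_right:
  fixes s :: "'l \<Rightarrow> 'k" and x :: 'l
  assumes s: "\<And>y. q (s y) = y"
  shows "(s \<longlongrightarrow> fibre_max x) (at_right x)"
proof (rule order_tendstoI)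
  fix a assume a: "fibre_max x < a"
  then have "x < q a"
    using fibre_max(1)[of x] fibre_max(2)[of a x] less_if_q_less[of "fibre_max x" a]
      less_if_q_less[of a "fibre_max x"] by (metis leD less_asym linorder_neqE)
  then show "\<forall>\<^sub>F y in at_right x. s y < a"
    by (intro eventually_at_rightI[of _ "q a"]) (auto intro: less_if_q_less simp: s)
next
  fix a assume "a < fibre_max x"
  then have "a < s y" if "x < y" for y
    using less_if_q_less[of "fibre_max x" "s y"] that by (simp add: s fibre_max(1))
  then show "\<forall>\<^sub>F y in at_right x. a < s y"
    by (simp add: eventually_at_filter)
qed

section \<open>A section of \<open>q\<close> continuous off \<open>Q\<close>\<close>

abbreviation Q :: "'l set" where
  "Q \<equiv> internal_multiple_points q"

lemma fibre_max_eq_fibre_min: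
  assumes "internal_point y" "y \<notin> Q"
  shows "fibre_max y = fibre_min y"
  using assms fibre_min(1)[of y] fibre_max(1)[of y]
  by (auto simp: internal_multiple_points_def)

text \<open>At a point of \<open>Q\<close> the flag names the side on which the jump is left.
  Elsewhere \<open>fibre_min\<close> is taken where only the limit from the left matters; otherwise
  \<open>fibre_max\<close> is right, as the point is isolated on the left or has a one-point
  fibre.\<close>

definition lift :: "('l \<Rightarrow> bool) \<Rightarrow> 'l \<Rightarrow> 'k" where
  "lift right y =
    (if (if y \<in> Q then right y else y isolated_in {y..}) then fibre_min y else fibre_max y)"

lemma q_lift [simp]: "q (lift right y) = y"
  by (simp add: lift_def fibre_min fibre_max)

lemma lift_tendsto:
  assumes "y \<notin> Q"
  shows "(lift right \<longlongrightarrow> lift right y) (at y)"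
proof (cases "internal_point y")
  case True
  then show ?thesis
    using assms section_tendsto_at_left[of "lift right" y, OF q_lift] section_tendsto_at_right[of "lift right" y, OF q_lift]
    by (simp add: filterlim_at_split lift_def fibre_max_eq_fibre_min)
next
  case False
  then consider "y isolated_in {y..}" | "y isolated_in {..y}" "\<not> y isolated_in {y..}"
    by (auto simp: internal_point_def external_point_def)
  then show ?thesis
  proof cases
    case 1
    then show ?thesis
      using assms section_tendsto_at_left[of "lift right" y, OF q_lift] isolated_in_atLeast_imp_at_right_bot[OF 1]
      by (simp add: filterlim_at_split lift_def)
  next
    case 2
    then show ?thesis
      using assms section_tendsto_at_right[of "lift right" y, OF q_lift] isolated_in_atMost_imp_at_left_bot[OF 2(1)]
      by (simp add: filterlim_at_split lift_def)
  qed
qed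

lemma continuous_section:
  assumes "Q = {}"
  shows "continuous_on UNIV (lift right)"
  using lift_tendsto assms by (simp add: continuous_on_def)

text \<open>Finitely many order-convex neighbourhoods on which \<open>h\<close> varies by less than
  \<open>e\<close> cover the space. If two such fibres had their minima in one of them, convexity
  would put the whole lower fibre there, contradicting its jump; so points inject into the
  cover.\<close>

lemma finite_large_jumps:
  fixes h :: "'k \<Rightarrow>\<^sub>C real" and e :: real
  assumes "0 < e"
  shows "finite {x. e < \<bar>h (fibre_max x) - h (fibre_min x)\<bar>}" (is "finite ?J")
proof -
  have "\<forall>p. \<exists>N. open N \<and> p \<in> N \<and> (\<forall>u\<in>N. \<forall>v\<in>N. \<bar>h u - h v\<bar> < e)
      \<and> (\<forall>u\<in>N. \<forall>w\<in>N. \<forall>v. u \<le> v \<longrightarrow> v \<le> w \<longrightarrow> v \<in> N)" (is "\<forall>p. \<exists>N. ?good p N")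
  proof
    fix p
    have "open {u. \<bar>h u - h p\<bar> < e/2}"
      by (intro open_Collect_less continuous_intros) auto
    then obtain N where N: "open N" "p \<in> N" "N \<subseteq> {u. \<bar>h u - h p\<bar> < e/2}"
      "\<And>u v w. u \<in> N \<Longrightarrow> w \<in> N \<Longrightarrow> u \<le> v \<Longrightarrow> v \<le> w \<Longrightarrow> v \<in> N"
      using open_contains_interval_neighbourhood[of "{u. \<bar>h u - h p\<bar> < e/2}" p] assms by auto
    have "\<bar>h u - h v\<bar> < e" if "u \<in> N" "v \<in> N" for u v
    proof -
      have "\<bar>h u - h p\<bar> < e/2" "\<bar>h v - h p\<bar> < e/2" using N(3) that by auto
      then show ?thesis by linarith
    qed
    then show "\<exists>N. ?good p N" using N(1,2,4) by (intro exI[of _ N]) blast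
  qed
  then obtain N where "\<forall>p. ?good p (N p)" by (rule choice[THEN exE])
  then have N: "\<And>p. open (N p)" "\<And>p. p \<in> N p"
    "\<And>p u v. u \<in> N p \<Longrightarrow> v \<in> N p \<Longrightarrow> \<bar>h u - h v\<bar> < e"
    "\<And>p u v w. u \<in> N p \<Longrightarrow> w \<in> N p \<Longrightarrow> u \<le> v \<Longrightarrow> v \<le> w \<Longrightarrow> v \<in> N p"
    by blast+
  obtain C where C: "finite C" "UNIV \<subseteq> (\<Union>p\<in>C. N p)"
    by (rule compactE_image[OF compact_domain, of UNIV N]) (use N(1,2) in auto)
  then obtain c where c: "\<And>u. c u \<in> C" "\<And>u. u \<in> N (c u)"
    by (metis UNIV_I UN_E subsetD)
  have "inj_on (c \<circ> fibre_min) ?J"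
  proof (rule linorder_inj_onI')
    fix x y assume xy: "x \<in> ?J" "y \<in> ?J" "x < y"
    have max_le: "fibre_max x \<le> fibre_min y"
      using xy less_if_q_less[of "fibre_max x" "fibre_min y"] by (simp add: fibre_min fibre_max)
    show "(c \<circ> fibre_min) x \<noteq> (c \<circ> fibre_min) y"
    proof
      assume "(c \<circ> fibre_min) x = (c \<circ> fibre_min) y"
      then have mem: "fibre_min x \<in> N (c (fibre_min x))" "fibre_min y \<in> N (c (fibre_min x))"
        using c(2)[of "fibre_min x"] c(2)[of "fibre_min y"] by simp_all
      have "fibre_max x \<in> N (c (fibre_min x))"
        by (rule N(4)[OF mem _ max_le]) (simp add: fibre_min fibre_max)
      then show False
        using N(3)[OF _ mem(1)] xy(1) by fastforce
    qed
  qed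
  moreover have "(c \<circ> fibre_min) ` ?J \<subseteq> C" using c(1) by auto
  ultimately show ?thesis using C(1) inj_on_finite by blast
qed

section \<open>Upper bound\<close>

text \<open>Composing with a section produces jumps at the points of \<open>Q\<close>; subtracting at each
  \<open>x \<in> Q\<close> a multiple of the one-sided bump \<open>\<psi> x\<close> closes the jump at \<open>x\<close>.\<close>

lemma averaging_operator_from_bumps:
  fixes \<theta> :: "'l \<Rightarrow> 'l \<Rightarrow> real" and right :: "'l \<Rightarrow> bool" and N :: nat
  defines "\<psi> \<equiv> \<lambda>x y. if (if right x then x < y else y < x) then \<theta> x y else 0"
  assumes cont_\<theta>: "\<And>x. x \<in> Q \<Longrightarrow> continuous_on UNIV (\<theta> x)"
    and \<theta>_bounds: "\<And>x y. x \<in> Q \<Longrightarrow> 0 \<le> \<theta> x y" "\<And>x y. x \<in> Q \<Longrightarrow> \<theta> x y \<le> 1"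
    and \<theta>_refl: "\<And>x. x \<in> Q \<Longrightarrow> \<theta> x x = 1"
    and finite_D: "\<And>y. finite {x \<in> Q. \<psi> x y \<noteq> 0}"
    and card_D: "\<And>y. card {x \<in> Q. \<psi> x y \<noteq> 0} \<le> N"
  obtains T where "averaging_operator q T" "onorm T \<le> 2 * real N + 1"
proof -
  define D where "D y = {x \<in> Q. \<psi> x y \<noteq> 0}" for y
  \<comment> \<open>Oriented from the value at \<open>lift right x\<close> to the limit on the side
    of the bump. As \<open>\<psi> x x = 0\<close>, the value at \<open>x\<close> itself is not
    corrected by its own bump.\<close>
  define jump :: "('k \<Rightarrow>\<^sub>C real) \<Rightarrow> 'l \<Rightarrow> real" where
    "jump h x = (if right x then h (fibre_max x) - h (fibre_min x)
                 else h (fibre_min x) - h (fibre_max x))" for h x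
  define t :: "('k \<Rightarrow>\<^sub>C real) \<Rightarrow> 'l \<Rightarrow> real" where
    "t h y = h (lift right y) - (\<Sum>x\<in>D y. jump h x * \<psi> x y)" for h y
  have D: "finite (D y)" "card (D y) \<le> N" for y
    using finite_D card_D by (auto simp: D_def)
  have \<psi>_abs: "\<bar>\<psi> x y\<bar> \<le> 1" if "x \<in> Q" for x y
    using \<theta>_bounds[OF that, of y] by (auto simp: \<psi>_def)
  have sum_bound: "\<bar>\<Sum>x\<in>A. jump h x * \<psi> x y\<bar> \<le> real N * b"
    if "A \<subseteq> D y" "\<And>x. x \<in> A \<Longrightarrow> \<bar>jump h x\<bar> \<le> b" "0 \<le> b" for A h y b
  proof -
    have "\<bar>\<Sum>x\<in>A. jump h x * \<psi> x y\<bar> \<le> (\<Sum>x\<in>A. \<bar>jump h x * \<psi> x y\<bar>)"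
      by (rule sum_abs)
    also have "\<dots> \<le> real (card A) * b"
    proof (rule sum_bounded_above)
      fix x assume "x \<in> A"
      then have "\<bar>jump h x\<bar> * \<bar>\<psi> x y\<bar> \<le> b * 1"
        using that \<psi>_abs[of x y] by (intro mult_mono) (auto simp: D_def)
      then show "\<bar>jump h x * \<psi> x y\<bar> \<le> b" by (simp add: abs_mult)
    qed
    also have "\<dots> \<le> real N * b"
      using card_mono[OF D(1) that(1)] D(2)[of y] that(3) by (intro mult_right_mono) auto
    finally show ?thesis .
  qed
  have \<theta>_tendsto: "(\<theta> x \<longlongrightarrow> \<theta> x y) (at y within S)" if "x \<in> Q" for x y S
    using cont_\<theta>[OF that] continuous_on_subset[of UNIV "\<theta> x" S]
    by (meson UNIV_I continuous_on_def subset_UNIV tendsto_within_subset)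
  \<comment> \<open>Away from \<open>x\<close> the truncated bump locally coincides with either
    \<open>\<theta> x\<close> or 0.\<close>
  have \<psi>_tendsto: "(\<psi> x \<longlongrightarrow> \<psi> x y) (at y)" if x: "x \<in> Q" "x \<noteq> y" for x y
  proof (cases "x < y")
    case True
    have "\<forall>\<^sub>F z in at y. (if right x then \<theta> x z else 0) = \<psi> x z"
      unfolding eventually_at_topological using True
      by (intro exI[of _ "{x<..}"]) (auto simp: \<psi>_def)
    moreover have "((\<lambda>z. if right x then \<theta> x z else 0) \<longlongrightarrow> \<psi> x y) (at y)"
      using True \<theta>_tendsto[OF x(1), of y UNIV] by (cases "right x") (auto simp: \<psi>_def)
    ultimately show ?thesis by (rule Lim_transform_eventually[rotated])
  next
    case False
    with x have "y < x" by simp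
    have "\<forall>\<^sub>F z in at y. (if right x then 0 else \<theta> x z) = \<psi> x z"
      unfolding eventually_at_topological using \<open>y < x\<close>
      by (intro exI[of _ "{..<x}"]) (auto simp: \<psi>_def)
    moreover have "((\<lambda>z. if right x then 0 else \<theta> x z) \<longlongrightarrow> \<psi> x y) (at y)"
      using \<open>y < x\<close> \<theta>_tendsto[OF x(1), of y UNIV] by (cases "right x") (auto simp: \<psi>_def)
    ultimately show ?thesis by (rule Lim_transform_eventually[rotated])
  qed
  have cont_t: "continuous_on UNIV (t h)" for h
    unfolding continuous_on_def
  proof
    fix y
    \<comment> \<open>\<open>G\<close> collects the section and the only bump that may be
      discontinuous at \<open>y\<close>; \<open>R\<close> collects the bumps of the other
      points.\<close>
    define G where "G z = h (lift right z) - (if y \<in> Q then jump h y * \<psi> y z else 0)" for z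
    define R where "R z = (\<Sum>x\<in>D z - {y}. jump h x * \<psi> x z)" for z
    have t_eq: "t h z = G z - R z" for z
    proof (cases "y \<in> D z")
      case True
      then show ?thesis
        using D(1)[of z] by (simp add: t_def G_def R_def sum.remove D_def)
    next
      case False
      then have "D z - {y} = D z" "y \<in> Q \<Longrightarrow> \<psi> y z = 0" by (auto simp: D_def)
      then show ?thesis by (simp add: t_def G_def R_def)
    qed
    have isCont_h: "isCont h u" for u
      by (rule continuous_on_interior[OF continuous_on_apply_bcontfun[of UNIV]]) simp
    have "(G \<longlongrightarrow> h (lift right y)) (at y)"
    proof (cases "y \<in> Q")
      case False
      then show ?thesis
        using isCont_tendsto_compose[OF isCont_h lift_tendsto[OF False, of right]]
        by (simp add: G_def[abs_def])
    next
      case True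
      have hl: "((\<lambda>z. h (lift right z)) \<longlongrightarrow> h (fibre_min y)) (at_left y)"
        and hr: "((\<lambda>z. h (lift right z)) \<longlongrightarrow> h (fibre_max y)) (at_right y)"
        by (intro isCont_tendsto_compose[OF isCont_h] section_tendsto_at_left
            section_tendsto_at_right q_lift)+
      have "\<forall>\<^sub>F z in at_left y. (if right y then 0 else \<theta> y z) = \<psi> y z"
        "\<forall>\<^sub>F z in at_right y. (if right y then \<theta> y z else 0) = \<psi> y z"
        by (auto simp: eventually_at_filter \<psi>_def intro!: always_eventually)
      moreover have "((\<lambda>z. if right y then 0 else \<theta> y z) \<longlongrightarrow> (if right y then 0 else 1)) (at_left y)"
        "((\<lambda>z. if right y then \<theta> y z else 0) \<longlongrightarrow> (if right y then 1 else 0)) (at_right y)"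
        using \<theta>_tendsto[OF True, of y "{..<y}"] \<theta>_tendsto[OF True, of y "{y<..}"] \<theta>_refl[OF True]
        by simp_all
      ultimately have \<psi>: "(\<psi> y \<longlongrightarrow> (if right y then 0 else 1)) (at_left y)"
        "(\<psi> y \<longlongrightarrow> (if right y then 1 else 0)) (at_right y)"
        by (auto intro: Lim_transform_eventually)
      \<comment> \<open>On one side the section already has the right limit; on the other it is off
        by \<open>jump h y\<close>, which the bump removes because
        \<open>\<theta> y y = 1\<close>.\<close>
      have "(G \<longlongrightarrow> h (fibre_min y) - jump h y * (if right y then 0 else 1)) (at_left y)"
        "(G \<longlongrightarrow> h (fibre_max y) - jump h y * (if right y then 1 else 0)) (at_right y)"
        using True unfolding G_def[abs_def] by (simp_all only: if_True) (intro tendsto_intros hl hr \<psi>)+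
      then show ?thesis
        using True by (auto simp: filterlim_at_split lift_def jump_def split: if_splits)
    qed
    moreover have "(R \<longlongrightarrow> R y) (at y)"
    proof (rule tendstoI)
      fix e :: real assume "0 < e"
      \<comment> \<open>\<open>R\<close> may involve infinitely many bumps near \<open>y\<close>, so
        it is approximated by the finite sum over jumps above \<open>\<delta>\<close>. The error is
        at most \<open>N * \<delta> < e / 4\<close> at \<open>z\<close> and at \<open>y\<close>,
        leaving \<open>e / 2\<close> for the finite sum.\<close>
      define \<delta> where "\<delta> = e / (4 * (real N + 1))"
      have "0 < \<delta>" using \<open>0 < e\<close> by (simp add: \<delta>_def)
      have \<delta>: "4 * (real N * \<delta>) < e" using \<open>0 < e\<close> by (simp add: \<delta>_def field_simps)
      define F where "F = {x \<in> Q. \<delta> < \<bar>jump h x\<bar>} - {y}"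
      have "F \<subseteq> {x. \<delta> < \<bar>h (fibre_max x) - h (fibre_min x)\<bar>}"
        by (auto simp: F_def jump_def abs_minus_commute split: if_splits)
      then have "finite F" using finite_large_jumps[OF \<open>0 < \<delta>\<close>] finite_subset by blast
      define S where "S z = (\<Sum>x\<in>F. jump h x * \<psi> x z)" for z
      have "(S \<longlongrightarrow> S y) (at y)"
        unfolding S_def by (intro tendsto_intros \<psi>_tendsto) (auto simp: F_def)
      then have "\<forall>\<^sub>F z in at y. dist (S z) (S y) < e / 2"
        using \<open>0 < e\<close> by (intro tendstoD) auto
      moreover have RS: "\<bar>R z - S z\<bar> \<le> real N * \<delta>" for z
      proof -
        have "S z = (\<Sum>x\<in>(D z - {y}) \<inter> F. jump h x * \<psi> x z)"
          unfolding S_def using \<open>finite F\<close> by (intro sum.mono_neutral_right) (auto simp: F_def D_def)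
        then have "R z - S z = (\<Sum>x\<in>(D z - {y}) - F. jump h x * \<psi> x z)"
          unfolding R_def using D(1)[of z] by (subst sum.Int_Diff[of _ _ F]) auto
        then show ?thesis
          using \<open>0 < \<delta>\<close> by (simp only:) (intro sum_bound; auto simp: F_def D_def)
      qed
      ultimately show "\<forall>\<^sub>F z in at y. dist (R z) (R y) < e"
      proof (elim eventually_mono)
        fix z assume "dist (S z) (S y) < e / 2"
        then show "dist (R z) (R y) < e"
          using RS[of z] RS[of y] \<delta> unfolding dist_real_def by linarith
      qed
    qed
    moreover have "h (lift right y) = G y"
      by (simp add: G_def \<psi>_def)
    ultimately have "((\<lambda>z. G z - R z) \<longlongrightarrow> G y - R y) (at y)"
      using tendsto_diff[of G] by simp
    then show "(t h \<longlongrightarrow> t h y) (at y)"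
      unfolding t_eq[abs_def] .
  qed
  define T where "T h = Bcontfun (t h)" for h
  have T [simp]: "T h y = t h y" for h y
    using compact_continuous_mem_bcontfun[OF compact_codomain cont_t]
    by (simp add: T_def Bcontfun_inverse)
  \<comment> \<open>At most \<open>N\<close> active bumps, each of size at most
    \<open>2 * norm h\<close>, plus the value of \<open>h\<close> on the section.\<close>
  have norm_T: "norm (T h) \<le> (2 * real N + 1) * norm h" for h
    unfolding norm_bcontfun_le_iff
  proof
    fix y
    have h: "\<bar>h u\<bar> \<le> norm h" for u
      using norm_bounded[of h u] by simp
    have "\<bar>jump h x\<bar> \<le> 2 * norm h" for x
      using h[of "fibre_min x"] h[of "fibre_max x"] by (cases "right x") (auto simp: jump_def abs_le_iff)
    then have "\<bar>\<Sum>x\<in>D y. jump h x * \<psi> x y\<bar> \<le> real N * (2 * norm h)"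
      by (intro sum_bound) auto
    moreover have "real N * (2 * norm h) + norm h = (2 * real N + 1) * norm h"
      by (simp add: algebra_simps)
    ultimately show "\<bar>T h y\<bar> \<le> (2 * real N + 1) * norm h"
      using h[of "lift right y"] unfolding T t_def by linarith
  qed
  have jump_add: "jump (g + h) x = jump g x + jump h x"
    and jump_scaleR: "jump (r *\<^sub>R h) x = r * jump h x" for g h x r
    by (simp_all add: jump_def algebra_simps)
  have "bounded_linear T"
  proof (rule bounded_linear_intro)
    show "T (g + h) = T g + T h" for g h
      by (rule bcontfun_eqI) (simp add: t_def jump_add distrib_right sum.distrib)
    show "T (r *\<^sub>R h) = r *\<^sub>R T h" for r h
      by (rule bcontfun_eqI)
        (simp add: t_def jump_scaleR right_diff_distrib sum_distrib_left mult.assoc)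
    show "norm (T h) \<le> norm h * (2 * real N + 1)" for h
      using norm_T[of h] by (simp add: mult.commute)
  qed
  moreover have "T (pullback q f) = f" for f
  proof -
    have "jump (pullback q f) x = 0" for x
      by (simp add: jump_def fibre_min fibre_max)
    then show ?thesis by (intro bcontfun_eqI) (simp add: t_def)
  qed
  ultimately show thesis
    using norm_T by (intro that[of T] onorm_bound) (auto simp: averaging_operator_def)
qed

text \<open>Points of the same internal order are isolated from one another on one side, so their
  bumps can be given disjoint supports; hence at most one bump per order overlaps at any point.\<close>

lemma averaging_operator_of_bounded_io:
  assumes N: "\<And>x m. x \<in> Q \<Longrightarrow> io_at_least Q m x \<Longrightarrow> m < N"
  obtains T where "averaging_operator q T" "onorm T \<le> 2 * real N + 1"
proof -
  have internal: "internal_point x" if "x \<in> Q" for x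
    using that by (simp add: internal_multiple_points_def)
  have "\<exists>m. io_at_least Q m x \<and> \<not> io_at_least Q (Suc m) x" if "x \<in> Q" for x
  proof (rule ccontr)
    assume "\<not> ?thesis"
    then have "io_at_least Q m x" for m
      by (induction m) (auto simp del: io_at_least.simps(2))
    then show False using N[OF that] by blast
  qed
  then obtain lev where lev: "\<And>x. x \<in> Q \<Longrightarrow> io_at_least Q (lev x) x"
    "\<And>x. x \<in> Q \<Longrightarrow> \<not> io_at_least Q (Suc (lev x)) x"
    by metis
  define A where "A m = {x \<in> Q. lev x = m}" for m
  \<comment> \<open>A point approached from both sides by points of its own level \<open>m\<close>
    would have order at least \<open>Suc m\<close>.\<close>
  have "(\<exists>z>x. \<forall>c\<in>A m. \<not> (x < c \<and> c < z)) \<or> (\<exists>z<x. \<forall>c\<in>A m. \<not> (z < c \<and> c < x))" if "x \<in> A m" for x m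
  proof (rule ccontr)
    assume "\<not> ?thesis"
    then have R: "\<And>z. x < z \<Longrightarrow> \<exists>y\<in>A m. x < y \<and> y < z"
      and L: "\<And>z. z < x \<Longrightarrow> \<exists>y\<in>A m. z < y \<and> y < x"
      by blast+
    have x: "x \<in> Q" "lev x = m" using \<open>x \<in> A m\<close> by (auto simp: A_def)
    have A: "y \<in> Q \<and> io_at_least Q m y" if "y \<in> A m" for y
      using that lev(1) by (auto simp: A_def)
    have "io_at_least Q (Suc m) x"
      unfolding io_at_least.simps
    proof (intro conjI)
      show "{y \<in> Q. y < x \<and> io_at_least Q m y} \<noteq> {}" "{y \<in> Q. y > x \<and> io_at_least Q m y} \<noteq> {}"
        using internal_point_dense(1,3)[OF internal[OF x(1)]] L R A by blast+
      show "isLub UNIV {y \<in> Q. y < x \<and> io_at_least Q m y} x"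
        using L A unfolding isLub_UNIV_iff by (auto simp flip: not_less)
      show "isGlb UNIV {y \<in> Q. y > x \<and> io_at_least Q m y} x"
        using R A unfolding isGlb_UNIV_iff by (auto simp flip: not_less)
    qed
    then show False using lev(2) x by auto
  qed
  then have "\<forall>m. \<exists>right I. \<forall>x\<in>A m. (if right x then \<exists>z>x. I x = {x<..<z} else \<exists>z<x. I x = {z<..<x})
    \<and> (\<forall>x'\<in>A m. x \<noteq> x' \<longrightarrow> I x \<inter> I x' = {})"
    using internal_point_dense(2)[OF internal]
    by (intro allI disjoint_one_sided_intervals) (auto simp: A_def)
  then obtain r J where rJ: "\<And>m x. x \<in> A m \<Longrightarrow>
      if r m x then \<exists>z>x. J m x = {x<..<z} else \<exists>z<x. J m x = {z<..<x}"
    "\<And>m x x'. x \<in> A m \<Longrightarrow> x' \<in> A m \<Longrightarrow> x \<noteq> x' \<Longrightarrow> J m x \<inter> J m x' = {}"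
    by metis
  define right where "right x = r (lev x) x" for x
  define I where "I x = J (lev x) x" for x
  have I: "if right x then \<exists>z>x. I x = {x<..<z} else \<exists>z<x. I x = {z<..<x}" if "x \<in> Q" for x
    using rJ(1)[of x "lev x"] that by (simp add: right_def I_def A_def)
  have I_disjoint: "I x \<inter> I x' = {}" if "x \<in> Q" "x' \<in> Q" "lev x = lev x'" "x \<noteq> x'" for x x'
    using rJ(2)[of x "lev x" x'] that by (simp add: I_def A_def)
  have "\<forall>x\<in>Q. \<exists>f. continuous_on UNIV f \<and> (\<forall>y. 0 \<le> f y \<and> f y \<le> (1::real)) \<and> f x = 1 \<and>
      (\<forall>y. (if right x then x < y else y < x) \<longrightarrow> f y \<noteq> 0 \<longrightarrow> y \<in> I x)"
    (is "\<forall>x\<in>Q. \<exists>f. ?bump x f")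
  proof
    fix x assume x: "x \<in> Q"
    \<comment> \<open>Only the chosen side is constrained: truncation in
      \<open>averaging_operator_from_bumps\<close> discards the other half of the bump.\<close>
    have "\<exists>U. open U \<and> x \<in> U \<and> (\<forall>y\<in>U. (if right x then x < y else y < x) \<longrightarrow> y \<in> I x)"
    proof (cases "right x")
      case True
      then obtain z where "x < z" "I x = {x<..<z}" using I[OF x] by auto
      then show ?thesis using True by (intro exI[of _ "{..<z}"]) auto
    next
      case False
      then obtain z where "z < x" "I x = {z<..<x}" using I[OF x] by auto
      then show ?thesis using False by (intro exI[of _ "{z<..}"]) auto
    qed
    then obtain U where U: "open U" "x \<in> U"
      "\<And>y. y \<in> U \<Longrightarrow> (if right x then x < y else y < x) \<Longrightarrow> y \<in> I x" by blast
    obtain f :: "'l \<Rightarrow> real" and W where "continuous_on UNIV f" "\<And>y. 0 \<le> f y" "\<And>y. f y \<le> 1"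
      "\<And>y. y \<notin> U \<Longrightarrow> f y = 0" "x \<in> W" "\<And>y. y \<in> W \<Longrightarrow> f y = 1"
      using bump_function[OF compact_codomain U(1,2)] by metis
    then show "\<exists>f. ?bump x f" using U by (intro exI[of _ f] conjI) blast+
  qed
  then obtain \<theta> where "\<forall>x\<in>Q. ?bump x (\<theta> x)" by (rule bchoice[THEN exE])
  then have \<theta>: "\<And>x. x \<in> Q \<Longrightarrow> continuous_on UNIV (\<theta> x)"
    "\<And>x y. x \<in> Q \<Longrightarrow> 0 \<le> \<theta> x y" "\<And>x y. x \<in> Q \<Longrightarrow> \<theta> x y \<le> 1" "\<And>x. x \<in> Q \<Longrightarrow> \<theta> x x = 1"
    "\<And>x y. x \<in> Q \<Longrightarrow> (if right x then x < y else y < x) \<Longrightarrow> \<theta> x y \<noteq> 0 \<Longrightarrow> y \<in> I x"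
    by blast+
  define D where "D y = {x \<in> Q. (if if right x then x < y else y < x then \<theta> x y else 0) \<noteq> 0}" for y
  have D: "x \<in> Q" "y \<in> I x" if "x \<in> D y" for x y
    using that \<theta>(5)[of x y] by (auto simp: D_def split: if_splits)
  \<comment> \<open>Two bumps active at \<open>y\<close> have intersecting intervals, hence
    different levels.\<close>
  have inj: "inj_on lev (D y)" for y
    using D[of _ y] I_disjoint by (intro inj_onI) blast
  have img: "lev ` D y \<subseteq> {..<N}" for y
    using D[of _ y] lev(1) N by blast
  have "finite (D y)" for y
    using inj_on_finite[OF inj img] by simp
  moreover have "card (D y) \<le> N" for y
    using card_inj_on_le[OF inj img] by simp
  ultimately show thesis
    using averaging_operator_from_bumps[of \<theta> right N, OF \<theta>(1-4)] that unfolding D_def by blast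
qed

end

section \<open>Assembling the norm bounds\<close>

theorem lemma2p7:
  fixes q :: "'k::linorder_topology \<Rightarrow> 'l::linorder_topology"
    and Q :: "'l set"
  assumes compact_K: "compact (UNIV :: 'k set)"
    and compact_L: "compact (UNIV :: 'l set)"
    and mono_q: "mono q"
    and cont_q: "continuous_on UNIV q"
    and surj_q: "surj q"
    and Q_def: "Q = internal_multiple_points q"
  shows
    "(k_complemented 1 (range (pullback q)) \<longleftrightarrow> Q = {})
     \<and> (Q = {} \<longrightarrow>
          (\<exists>i :: 'l \<Rightarrow> 'k. continuous_on UNIV i \<and> q \<circ> i = id)
          \<and> (\<exists>T. regular_averaging_operator q T))
     \<and> (complemented (range (pullback q)) \<longleftrightarrow> io Q < \<infinity>)
     \<and> (\<forall>n::int. n \<ge> -1 \<longrightarrow> io Q \<ge> ereal (real_of_int n) \<longrightarrow>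
          (\<forall>P. projection_onto P (range (pullback q)) \<longrightarrow>
             onorm P \<ge> real_of_int (2 + \<lceil>(real_of_int n - 1) / 2\<rceil>)))
     \<and> (\<forall>n::int. n \<ge> -1 \<longrightarrow> io Q \<le> ereal (real_of_int n) \<longrightarrow>
          (\<exists>P. projection_onto P (range (pullback q)) \<and>
             onorm P \<le> real_of_int (2 * n + 3)))"
proof -
  interpret compact_line_surjection q
    by standard fact+
  have lower: "real n + 2 \<le> onorm P"
    if P: "projection_onto P (range (pullback q))" and n: "ereal (real n) \<le> io Q" for P n
  proof -
    obtain T where T: "averaging_operator q T" "onorm T \<le> onorm P"
      using averaging_operator_of_projection[OF P] by blast
    then have "T 0 = 0"
      by (simp add: averaging_operator_def linear_0 bounded_linear.linear)
    obtain x where "x \<in> Q" "io_at_least Q n x" using le_io_imp_io_at_least[OF n] by blast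
    \<comment> \<open>The zero function on the whole space starts the iteration with deviation
      0.\<close>
    then have "real n + 2 + 0 \<le> onorm T"
      unfolding Q_def
      by (rule onorm_averaging_operator_ge_io[OF T(1), of x n 0 UNIV 0]) (simp_all add: \<open>T 0 = 0\<close>)
    then show ?thesis using T(2) by simp
  qed
  have lower_1: "1 \<le> onorm P" if P: "projection_onto P (range (pullback q))" for P
  proof -
    obtain T where T: "averaging_operator q T" "onorm T \<le> onorm P"
      using averaging_operator_of_projection[OF P] by blast
    then have "T 0 = 0"
      by (simp add: averaging_operator_def linear_0 bounded_linear.linear)
    then show ?thesis
      using onorm_averaging_operator_ge_deviation[OF T(1), of 0 UNIV undefined 0] T(2) by simp
  qed
  have upper: "\<exists>P. projection_onto P (range (pullback q)) \<and> onorm P \<le> 2 * real N + 1"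
    if N: "\<And>x m. x \<in> Q \<Longrightarrow> io_at_least Q m x \<Longrightarrow> m < N" for N
  proof -
    obtain T where "averaging_operator q T" "onorm T \<le> 2 * real N + 1"
      using averaging_operator_of_bounded_io[of N] N unfolding Q_def by blast
    then show ?thesis
      using projection_of_averaging_operator[of T] order_trans by blast
  qed
  have a: "real_of_int (2 + \<lceil>(real_of_int n - 1) / 2\<rceil>) \<le> onorm P"
    if n: "n \<ge> -1" "ereal (real_of_int n) \<le> io Q" and P: "projection_onto P (range (pullback q))"
    for n P
  proof (cases "n = -1")
    \<comment> \<open>Here the claimed bound is \<open>2 + (-1) = 1\<close>, which needs no point of
      \<open>Q\<close>.\<close>
    case True
    then show ?thesis using lower_1[OF P] by simp
  next
    case False
    then obtain k where k: "n = int k" using n(1) nonneg_int_cases[of n] by auto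
    have "\<lceil>(real_of_int n - 1) / 2\<rceil> \<le> n" using k by (simp add: ceiling_le_iff)
    moreover have "real k + 2 \<le> onorm P" using lower[OF P, of k] n(2) k by simp
    ultimately show ?thesis using k by linarith
  qed
  have b: "\<exists>P. projection_onto P (range (pullback q)) \<and> onorm P \<le> real_of_int (2 * n + 3)"
    if n: "n \<ge> -1" "io Q \<le> ereal (real_of_int n)" for n
  proof -
    \<comment> \<open>Orders from 0 to \<open>n\<close> make \<open>N = n + 1\<close> levels, and
      \<open>2 * N + 1 = 2 * n + 3\<close>. For \<open>n = -1\<close> this gives
      \<open>N = 0\<close>.\<close>
    have "m < nat (n + 1)" if "x \<in> Q" "io_at_least Q m x" for x m
    proof -
      have "ereal (real m) \<le> ereal (real_of_int n)"
        using io_at_least_imp_le_io[OF that] n(2) by (rule order_trans)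
      then show ?thesis by simp
    qed
    from upper[OF this] show ?thesis using n(1) by (simp add: algebra_simps)
  qed
  have "k_complemented 1 (range (pullback q)) \<longleftrightarrow> Q = {}"
  proof
    assume "k_complemented 1 (range (pullback q))"
    then obtain P where P: "projection_onto P (range (pullback q))" "onorm P \<le> 1"
      by (auto simp: k_complemented_def)
    show "Q = {}"
    proof (rule ccontr)
      assume "Q \<noteq> {}"
      then obtain x where "x \<in> Q" by blast
      then have "ereal (real 0) \<le> io Q" by (rule io_at_least_imp_le_io) simp
      from lower[OF P(1) this] P(2) show False by simp
    qed
  next
    assume "Q = {}"
    then show "k_complemented 1 (range (pullback q))"
      using b[of "-1"] by (simp add: k_complemented_def io_def one_ereal_def)
  qed
  moreover have "(\<exists>i :: 'l \<Rightarrow> 'k. continuous_on UNIV i \<and> q \<circ> i = id)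
    \<and> (\<exists>T. regular_averaging_operator q T)" if "Q = {}"
  proof -
    define i where "i = lift (\<lambda>_. True)"
    have i: "continuous_on UNIV i" "\<And>y. q (i y) = y"
      using continuous_section that by (simp_all add: i_def Q_def)
    \<comment> \<open>Composition with a continuous section preserves constants and positivity, and
      inverts \<open>pullback q\<close> on its range.\<close>
    define T :: "('k \<Rightarrow>\<^sub>C real) \<Rightarrow> ('l \<Rightarrow>\<^sub>C real)" where "T = pullback i"
    have T: "T h y = h (i y)" for h y
      by (simp add: T_def apply_pullback[OF i(1)])
    have "bounded_linear T"
    proof (rule bounded_linear_intro[of _ 1])
      show "norm (T h) \<le> norm h * 1" for h
        using norm_bcontfun_le_iff[of h "norm h"] by (simp add: norm_bcontfun_le_iff T)
    qed (auto intro!: bcontfun_eqI simp: T)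
    then have "regular_averaging_operator q T"
      by (auto simp: regular_averaging_operator_def averaging_operator_def T i(2) intro!: bcontfun_eqI)
    then show ?thesis using i by (auto simp: fun_eq_iff)
  qed
  moreover have "complemented (range (pullback q)) \<longleftrightarrow> io Q < \<infinity>"
  proof
    assume "complemented (range (pullback q))"
    then obtain P where P: "projection_onto P (range (pullback q))"
      by (auto simp: complemented_def)
    \<comment> \<open>An infinite order would give the lower bound \<open>n + 2\<close> for this
      \<open>n\<close> as well.\<close>
    obtain n :: nat where "onorm P < real n" using reals_Archimedean2 by blast
    then show "io Q < \<infinity>" using lower[OF P, of n] by (cases "io Q") auto
  next
    assume "io Q < \<infinity>"
    then obtain n :: nat where "io Q < ereal (real n)"
      using less_PInf_Ex_of_nat[of "io Q"] by auto
    then have "io Q \<le> ereal (real_of_int (int n))" by simp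
    then show "complemented (range (pullback q))"
      using b[of "int n"] by (auto simp: complemented_def)
  qed
  ultimately show ?thesis using a b by blast
qed

end
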